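(* Let $a,b,u$ be indeterminates and let $g=g(x)$ be the formal power series solution of the differential equation \[g'=u\,g^{b+1}+a\,x\,g^{b}g'\] with $g(0)=1$, where the prime denotes the derivative with respect to $x$. Then, for an indeterminate $c$, \[g^c=\sum_{n=0}^\infty P_n(a,bu,cu)\frac{x^n}{n!}\qquad\text{and}\qquad \log g=\sum_{n=1}^\infty u\,Q_n(a,bu)\frac{x^n}{n!}.\]
   Context: For $n\ge1$, $P_n(a,b,c)=c\prod_{i=1}^{n-1}(ia+(n-i)b+c)$, with the convention $P_0(a,b,c)=1$, and $Q_n(a,b)=\prod_{i=1}^{n-1}(ia+(n-i)b)$ is the coefficient of $c$ in $P_n(a,b,c)$. Powers $g^c$ of a power series with constant term $1$ are defined by $g^c=\exp(c\log g)$. *)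

theory Defs
  imports "HOL-Computational_Algebra.Computational_Algebra"
begin

definition P :: "nat \<Rightarrow> 'a \<Rightarrow> 'a \<Rightarrow> 'a \<Rightarrow> 'a::comm_ring_1" where
  "P n a b c =
     (if n = 0 then 1
      else c * (\<Prod>i = 1..n - 1. of_nat i * a + of_nat (n - i) * b + c))"

definition Q :: "nat \<Rightarrow> 'a \<Rightarrow> 'a \<Rightarrow> 'a::comm_ring_1" where
  "Q n a b = (\<Prod>i = 1..n - 1. of_nat i * a + of_nat (n - i) * b)"

text \<open>
  Logarithm and powers are meaningful only for series with constant term 1: composition
  \<^const>\<open>fps_compose\<close> requires an inner series with constant term 0. Note that
  \<^term>\<open>fps_ln 1\<close> is the series of log (1 + x) and \<^term>\<open>fps_exp 1\<close> that of exp x.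
\<close>

definition fps_log :: "'a::field_char_0 fps \<Rightarrow> 'a fps" where
  "fps_log g = fps_ln 1 oo (g - 1)"

definition fps_pow :: "'a::field_char_0 fps \<Rightarrow> 'a \<Rightarrow> 'a fps" where
  "fps_pow g c = fps_exp 1 oo (fps_const c * fps_log g)"

text \<open>
  The indeterminates are rendered as arbitrary elements of an arbitrary field of
  characteristic 0; the formal reading is the instance where that field is the fraction field
  of the polynomial ring in a, b, u, c over the rationals.
\<close>

definition solves_ode :: "'a::field_char_0 \<Rightarrow> 'a \<Rightarrow> 'a \<Rightarrow> 'a fps \<Rightarrow> bool" where
  "solves_ode a b u g \<longleftrightarrow>
     fps_nth g 0 = 1 \<and>
     fps_deriv g = fps_const u * fps_pow g (b + 1)
                   + fps_const a * fps_X * fps_pow g b * fps_deriv g"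

end

theory Submission
  imports Defs
begin

text \<open>
  Put \<open>L = log g\<close>, so that the equation reads \<open>L' = g\<^sup>b (u + a x L')\<close>. Multiplying by \<open>g\<^sup>c\<close>,
  the series \<open>G\<^sub>c = L' g\<^sup>c\<close> satisfy \<open>G\<^sub>c = u g\<^bsup>b+c\<^esup> + a x G\<^bsub>b+c\<^esub>\<close>; since
  \<open>(g\<^bsup>b+c\<^esup>)' = (b + c) G\<^bsub>b+c\<^esub>\<close>, comparing coefficients of \<open>x\<^sup>n\<close> expresses that of \<open>G\<^sub>c\<close> as
  a multiple of the coefficient of \<open>x\<^bsup>n-1\<^esup>\<close> in \<open>G\<^bsub>b+c\<^esub>\<close>, which yields the product formula
  and, at \<open>c = 0\<close>, the logarithm. Working with \<open>G\<^sub>c\<close> instead of \<open>g\<^sup>c\<close> avoids a division by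
  \<open>b + c\<close>. Existence: for \<open>u \<noteq> 0\<close> the inverse function \<open>x = X(L)\<close> satisfies the linear
  equation \<open>u X' = exp (-b L) - a X\<close>, which is solved by variation of constants.
\<close>

lemma fps_log_nth_0 [simp]: "fps_nth (fps_log g) 0 = 0"
  by (simp add: fps_log_def)

lemma fps_exp_compose_fps_const_mult:
  fixes L :: "'a::field_char_0 fps"
  assumes "fps_nth L 0 = 0"
  shows "fps_exp d oo (fps_const c * L) = fps_exp (c * d) oo L"
proof -
  have "fps_const c * L = (fps_const c * fps_X) oo L"
    using assms by (simp add: fps_compose_mult_distrib)
  then have "fps_exp d oo (fps_const c * L) = fps_exp d oo (fps_const c * fps_X) oo L"
    using assms by (simp add: fps_compose_assoc)
  then show ?thesis by simp
qed

text \<open>Moving the exponent to the outer series gives all powers of \<open>g\<close> the same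
  inner series, so their exponent laws follow from those of \<open>fps_exp\<close>.\<close>

lemma fps_pow_eq_fps_exp_compose: "fps_pow g c = fps_exp c oo fps_log g"
  by (simp add: fps_pow_def fps_exp_compose_fps_const_mult)

lemma fps_exp_compose_add:
  fixes L :: "'a::field_char_0 fps"
  assumes "fps_nth L 0 = 0"
  shows "fps_exp (c + d) oo L = (fps_exp c oo L) * (fps_exp d oo L)"
  using assms by (simp add: fps_exp_add_mult fps_compose_mult_distrib)

lemma fps_deriv_fps_exp_compose:
  fixes L :: "'a::field_char_0 fps"
  assumes "fps_nth L 0 = 0"
  shows "fps_deriv (fps_exp c oo L) = fps_const c * (fps_exp c oo L) * fps_deriv L"
  using assms by (simp add: fps_compose_deriv fps_compose_mult_distrib)

text \<open>\<open>fps_ln 1\<close> is the compositional inverse of \<open>fps_exp 1 - 1\<close>,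
  and composition is associative.\<close>

lemma fps_exp_compose_fps_log:
  fixes g :: "'a::field_char_0 fps"
  assumes "fps_nth g 0 = 1"
  shows "fps_exp 1 oo fps_log g = g"
proof -
  have "(fps_exp 1 - 1) oo fps_ln (1::'a) = fps_X"
    by (simp add: fps_ln_fps_exp_inv fps_inv_right)
  then have "(fps_exp 1 - 1) oo fps_log g = fps_X oo (g - 1)"
    using assms by (simp add: fps_log_def fps_compose_assoc)
  also have "\<dots> = g - 1"
    using assms by simp
  finally show ?thesis
    by (simp add: fps_compose_sub_distrib)
qed

lemma fps_log_fps_exp_compose:
  fixes L :: "'a::field_char_0 fps"
  assumes "fps_nth L 0 = 0"
  shows "fps_log (fps_exp 1 oo L) = L"
proof -
  have "fps_ln (1::'a) oo (fps_exp 1 - 1) = fps_X"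
    by (simp add: fps_ln_fps_exp_inv fps_inv)
  then have "fps_ln 1 oo ((fps_exp 1 - 1) oo L) = fps_X oo L"
    using assms by (simp add: fps_compose_assoc)
  then show ?thesis
    using assms by (simp add: fps_log_def fps_compose_sub_distrib)
qed

text \<open>Since \<open>g' = g L'\<close> and \<open>g^(b+1) = g^b g\<close>, every term of the
  equation carries the nonzero factor \<open>g\<close>, which cancels.\<close>

lemma solves_ode_iff_fps_log:
  fixes g :: "'a::field_char_0 fps"
  assumes g0: "fps_nth g 0 = 1"
  defines "L \<equiv> fps_log g"
  shows "solves_ode a b u g \<longleftrightarrow>
    fps_deriv L = (fps_exp b oo L) * (fps_const u + fps_const a * fps_X * fps_deriv L)"
proof -
  have L0: "fps_nth L 0 = 0" by (simp add: L_def)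
  have g: "fps_exp 1 oo L = g"
    unfolding L_def using g0 by (rule fps_exp_compose_fps_log)
  have dg: "fps_deriv g = g * fps_deriv L"
    using fps_deriv_fps_exp_compose[OF L0, of 1] g by simp
  have pow: "fps_pow g (b + 1) = (fps_exp b oo L) * g"
    by (simp add: fps_pow_eq_fps_exp_compose fps_exp_compose_add[OF L0] g flip: L_def)
  have "g \<noteq> 0" using g0 by auto
  have "solves_ode a b u g \<longleftrightarrow> g * fps_deriv L =
      g * ((fps_exp b oo L) * (fps_const u + fps_const a * fps_X * fps_deriv L))"
    unfolding solves_ode_def pow dg
    by (simp add: g0 fps_pow_eq_fps_exp_compose algebra_simps flip: L_def)
  then show ?thesis using \<open>g \<noteq> 0\<close> by simp
qed

lemma fps_nth_deriv_times_fps_exp_compose: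
  fixes L :: "'a::field_char_0 fps"
  assumes L0: "fps_nth L 0 = 0"
    and ode: "fps_deriv L = (fps_exp b oo L) * (fps_const u + fps_const a * fps_X * fps_deriv L)"
  shows "fps_nth (fps_deriv L * (fps_exp c oo L)) n =
    u * (\<Prod>i = 1..n. of_nat i * a + of_nat (Suc n - i) * (b * u) + c * u) / fact n"
\<comment> \<open>The exponent must vary because the recursion passes from \<open>c\<close> to
  \<open>b + c\<close>.\<close>
proof (induction n arbitrary: c)
  define G where "G c = fps_deriv L * (fps_exp c oo L)" for c
  have G: "G c = fps_const u * (fps_exp (b + c) oo L) + fps_const a * (fps_X * G (b + c))" for c
  proof -
    have "G c = (fps_exp b oo L) * (fps_const u + fps_const a * fps_X * fps_deriv L)
        * (fps_exp c oo L)"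
      unfolding G_def by (subst ode) (rule refl)
    then show ?thesis
      using L0 by (simp add: G_def fps_exp_compose_add algebra_simps)
  qed
  {
    case 0
    show ?case using G[of c] by (simp add: G_def)
  next
    case (Suc n)
    have "of_nat (Suc n) * fps_nth (fps_exp (b + c) oo L) (Suc n) = (b + c) * fps_nth (G (b + c)) n"
      using fps_deriv_fps_exp_compose[OF L0, of "b + c"]
      by (metis (no_types, lifting) G_def Suc_eq_plus1 fps_deriv_nth fps_mult_left_const_nth
          mult.assoc mult.commute)
    then have "of_nat (Suc n) * fps_nth (G c) (Suc n)
        = (of_nat (Suc n) * a + b * u + c * u) * fps_nth (G (b + c)) n"
      by (subst G) (simp add: algebra_simps)
    also have "fps_nth (G (b + c)) n = u *
        (\<Prod>i = 1..n. of_nat i * a + of_nat (Suc n - i) * (b * u) + (b + c) * u) / fact n"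
      using Suc.IH[of "b + c"] by (simp only: G_def)
    \<comment> \<open>The shift of the exponent adds \<open>b * u\<close> to each factor, which
      raises \<open>Suc n - i\<close> to \<open>Suc (Suc n) - i\<close>. The multiplier in front is
      the missing factor at \<open>i = Suc n\<close>.\<close>
    also have "(\<Prod>i = 1..n. of_nat i * a + of_nat (Suc n - i) * (b * u) + (b + c) * u)
        = (\<Prod>i = 1..n. of_nat i * a + of_nat (Suc (Suc n) - i) * (b * u) + c * u)"
      by (intro prod.cong refl) (auto simp: Suc_diff_le algebra_simps)
    also have "(of_nat (Suc n) * a + b * u + c * u) * (u * \<dots> / fact n) =
        u * (\<Prod>i = 1..Suc n. of_nat i * a + of_nat (Suc (Suc n) - i) * (b * u) + c * u) / fact n"
      by (simp add: algebra_simps)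
    finally have *: "of_nat (Suc n) * fps_nth (G c) (Suc n) =
        u * (\<Prod>i = 1..Suc n. of_nat i * a + of_nat (Suc (Suc n) - i) * (b * u) + c * u) / fact n" .
    have "(of_nat (Suc n) :: 'a) \<noteq> 0" by (rule of_nat_neq_0)
    then show ?case
      using * unfolding G_def[symmetric] fact_Suc
      by (simp add: divide_simps mult_ac del: of_nat_Suc prod.cl_ivl_Suc)
  }
qed

lemma solves_ode_imp_fps_log_eq:
  fixes g :: "'a::field_char_0 fps"
  assumes "solves_ode a b u g"
  shows "fps_log g = Abs_fps (\<lambda>n. if n = 0 then 0 else u * Q n a (b * u) / fact n)"
proof (rule fps_ext)
  fix n
  have ode: "fps_deriv (fps_log g) = (fps_exp b oo fps_log g) *
      (fps_const u + fps_const a * fps_X * fps_deriv (fps_log g))"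
    using assms solves_ode_iff_fps_log solves_ode_def by blast
  show "fps_nth (fps_log g) n =
      fps_nth (Abs_fps (\<lambda>n. if n = 0 then 0 else u * Q n a (b * u) / fact n)) n"
  proof (cases n)
    case (Suc m)
    have "(of_nat (Suc m) :: 'a) \<noteq> 0" by (rule of_nat_neq_0)
    \<comment> \<open>At exponent 0 the power is 1, which leaves the coefficient of
      \<open>L'\<close> alone.\<close>
    with fps_nth_deriv_times_fps_exp_compose[OF fps_log_nth_0 ode, of 0 m] show ?thesis
      by (simp add: Suc Q_def divide_simps mult_ac del: of_nat_Suc)
  qed simp
qed

lemma solves_ode_imp_fps_pow_eq:
  fixes g :: "'a::field_char_0 fps"
  assumes "solves_ode a b u g"
  shows "fps_pow g c = Abs_fps (\<lambda>n. P n a (b * u) (c * u) / fact n)"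
proof (rule fps_ext)
  fix n
  have ode: "fps_deriv (fps_log g) = (fps_exp b oo fps_log g) *
      (fps_const u + fps_const a * fps_X * fps_deriv (fps_log g))"
    using assms solves_ode_iff_fps_log solves_ode_def by blast
  show "fps_nth (fps_pow g c) n = fps_nth (Abs_fps (\<lambda>n. P n a (b * u) (c * u) / fact n)) n"
  proof (cases n)
    case 0
    then show ?thesis by (simp add: fps_pow_eq_fps_exp_compose P_def)
  next
    case (Suc m)
    have nz: "(of_nat (Suc m) :: 'a) \<noteq> 0" by (rule of_nat_neq_0)
    \<comment> \<open>This \<open>c\<close> joins the \<open>u\<close> in the coefficient formula to
      give the leading factor \<open>c * u\<close> of \<open>P\<close>.\<close>
    have "fps_deriv (fps_pow g c) =
        fps_const c * (fps_deriv (fps_log g) * (fps_exp c oo fps_log g))"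
      by (simp add: fps_pow_eq_fps_exp_compose fps_deriv_fps_exp_compose mult_ac)
    then have "fps_nth (fps_deriv (fps_pow g c)) m =
        c * fps_nth (fps_deriv (fps_log g) * (fps_exp c oo fps_log g)) m"
      by simp
    also note fps_nth_deriv_times_fps_exp_compose[OF fps_log_nth_0 ode]
    finally show ?thesis
      using nz by (simp add: Suc P_def divide_simps mult_ac del: of_nat_Suc)
  qed
qed

lemma solves_ode_exists:
  fixes a b u :: "'a::field_char_0"
  shows "\<exists>g. solves_ode a b u g"
proof -
  obtain L :: "'a fps" where L0: "fps_nth L 0 = 0"
    and ode: "fps_deriv L = (fps_exp b oo L) * (fps_const u + fps_const a * fps_X * fps_deriv L)"
  proof (cases "u = 0")
    \<comment> \<open>Here \<open>g = 1\<close> is a solution.\<close>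
    case True
    then show ?thesis by (intro that[of 0]) simp_all
  next
    case False
    define s where "s = a / u"
    \<comment> \<open>The homogeneous equation \<open>X' = - s X\<close> has the solution
      \<open>fps_exp (- s)\<close>. Integrating from 0 makes \<open>X\<close> vanish at 0.\<close>
    define X where
      "X = fps_exp (- s) * fps_integral0 (fps_const (1 / u) * fps_exp (s - b))"
    have X0: "fps_nth X 0 = 0" by (simp add: X_def)
    have dX: "fps_deriv X = fps_const (1 / u) * fps_exp (- b) - fps_const s * X"
      using fps_exp_add_mult[of "- s" "s - b"]
      by (simp add: X_def fps_deriv_fps_integral algebra_simps flip: fps_const_neg)
    \<comment> \<open>A nonzero linear coefficient makes \<open>X\<close> invertible under
      composition.\<close>
    have "fps_nth (fps_deriv X) 0 = 1 / u"
      unfolding dX using X0 by simp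
    then have X1: "fps_nth X 1 \<noteq> 0" using False by simp
    define L where "L = fps_inv X"
    have L0: "fps_nth L 0 = 0" by (simp add: L_def fps_inv_def)
    have XL: "X oo L = fps_X"
      unfolding L_def using X0 X1 by (rule fps_inv_right)
    \<comment> \<open>Differentiating \<open>X(L(x)) = x\<close> and multiplying by \<open>u\<close>
      turns the linear equation for \<open>X\<close> into the one for \<open>L\<close>.\<close>
    have "1 = fps_deriv (X oo L)" by (simp add: XL)
    also have "\<dots> = (fps_const (1 / u) * (fps_exp (- b) oo L) - fps_const s * fps_X) * fps_deriv L"
      unfolding fps_compose_deriv[OF L0] dX
      by (simp only: fps_compose_sub_distrib fps_compose_mult_distrib[OF L0] fps_const_compose XL)
    finally have "fps_const u * 1 = fps_const u *
        ((fps_const (1 / u) * (fps_exp (- b) oo L) - fps_const s * fps_X) * fps_deriv L)"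
      by simp
    also have "\<dots> = (fps_const (u * (1 / u)) * (fps_exp (- b) oo L) - fps_const (u * s) * fps_X)
        * fps_deriv L"
      by (simp only: fps_const_mult [symmetric] algebra_simps)
    also have "\<dots> = (fps_exp (- b) oo L) * fps_deriv L - fps_const a * fps_X * fps_deriv L"
      using False by (simp add: s_def algebra_simps)
    finally have *: "fps_const u + fps_const a * fps_X * fps_deriv L
        = (fps_exp (- b) oo L) * fps_deriv L"
      by (simp add: algebra_simps)
    have "(fps_exp b oo L) * (fps_exp (- b) oo L) = 1"
      using fps_exp_compose_add[OF L0, of b "- b"] by simp
    then have "fps_deriv L =
        (fps_exp b oo L) * (fps_const u + fps_const a * fps_X * fps_deriv L)"
      unfolding * by (simp flip: mult.assoc)
    with L0 show ?thesis by (rule that)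
  qed
  have "solves_ode a b u (fps_exp 1 oo L)"
    using ode by (subst solves_ode_iff_fps_log) (simp_all add: fps_log_fps_exp_compose L0)
  then show ?thesis ..
qed

theorem theorem5p1:
  fixes a b u :: "'a::field_char_0"
  shows "(\<exists>!g. solves_ode a b u g) \<and>
    (\<forall>g. solves_ode a b u g \<longrightarrow>
      (\<forall>c. fps_pow g c = Abs_fps (\<lambda>n. P n a (b * u) (c * u) / fact n)) \<and>
      fps_log g = Abs_fps (\<lambda>n. if n = 0 then 0 else u * Q n a (b * u) / fact n))"
proof -
  have "g = h" if "solves_ode a b u g" "solves_ode a b u h" for g h
  proof -
    \<comment> \<open>The closed form of the logarithm depends only on \<open>a\<close>,
      \<open>b\<close> and \<open>u\<close>.\<close>
    have "fps_log g = fps_log h"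
      using that by (simp add: solves_ode_imp_fps_log_eq)
    moreover have "fps_nth g 0 = 1" "fps_nth h 0 = 1"
      using that by (simp_all add: solves_ode_def)
    ultimately show ?thesis
      by (metis fps_exp_compose_fps_log)
  qed
  then show ?thesis
    using solves_ode_exists[of a b u] solves_ode_imp_fps_pow_eq solves_ode_imp_fps_log_eq
    by blast
qed

end
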